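(* Let $\mathcal P$ be a primitive integral Apollonian circle packing. For any integer $m$ with $\gcd(m,30)=1$, every residue class modulo $m$ occurs as the value of some circle curvature in the packing $\mathcal P$.
   Context: A Descartes configuration is a set of four mutually tangent circles (straight lines allowed, with curvature $0$) with disjoint interiors; an enclosing circle has its exterior as "interior" and is given negative curvature. The curvatures $(a,b,c,d)$ of a Descartes configuration satisfy the Descartes equation $2(a^2+b^2+c^2+d^2)=(a+b+c+d)^2$. An Apollonian circle packing is a packing of circles constructed from an initial Descartes configuration by repeatedly filling the interstices between mutually tangent circles with further tangent circles. If the initial configuration has curvature vector $\mathbf v=(a,b,c,d)^T$, the curvatures occurring in the packing are exactly the entries of the vectors $M\mathbf v$ with $M$ in the group generated by $S_1,S_2,S_3,S_4$, where $S_i$ replaces the entry $v_i$ of a vector by $2\sum_{j\ne i}v_j-v_i$ and leaves the other entries unchanged. The packing is integral if all curvatures are integers, and primitive integral if moreover the quadruples of curvatures of its Descartes configurations have gcd $1$. *)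

theory Defs
  imports "HOL-Analysis.Analysis" "HOL-Number_Theory.Cong"
begin

text \<open>
  Circles and straight lines in the plane, each with a chosen side as its interior:
  a disc, the exterior of a circle (an enclosing circle), or an open half-plane.
\<close>

datatype gcircle =
    Disc complex real
  | Enclosing complex real
  | HalfPlane complex real

text \<open>A half-plane is given by its unit normal vector and its offset.\<close>

fun is_gcircle :: "gcircle \<Rightarrow> bool" where
  "is_gcircle (Disc c r) \<longleftrightarrow> r > 0"
| "is_gcircle (Enclosing c r) \<longleftrightarrow> r > 0"
| "is_gcircle (HalfPlane n t) \<longleftrightarrow> norm n = 1"

fun gint :: "gcircle \<Rightarrow> complex set" where
  "gint (Disc c r) = ball c r"
| "gint (Enclosing c r) = - cball c r"
| "gint (HalfPlane n t) = {z. n \<bullet> z > t}"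

fun curvature :: "gcircle \<Rightarrow> real" where
  "curvature (Disc c r) = 1 / r"
| "curvature (Enclosing c r) = - (1 / r)"
| "curvature (HalfPlane n t) = 0"

text \<open>
  The points of a circle or line in the extended plane, where \<open>None\<close> is the point at infinity,
  which lies on every line.
\<close>

fun gpoints :: "gcircle \<Rightarrow> complex option set" where
  "gpoints (Disc c r) = Some ` sphere c r"
| "gpoints (Enclosing c r) = Some ` sphere c r"
| "gpoints (HalfPlane n t) = insert None (Some ` {z. n \<bullet> z = t})"

text \<open>Two distinct parallel lines are tangent, their common point being at infinity.\<close>

definition tangent :: "gcircle \<Rightarrow> gcircle \<Rightarrow> bool" where
  "tangent x y \<longleftrightarrow> (\<exists>!p. p \<in> gpoints x \<inter> gpoints y)"

definition descartes_config :: "gcircle set \<Rightarrow> bool" where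
  "descartes_config S \<longleftrightarrow> card S = 4 \<and> (\<forall>x\<in>S. is_gcircle x) \<and>
     pairwise (\<lambda>x y. tangent x y \<and> gint x \<inter> gint y = {}) S"

text \<open>
  A circle filling an interstice between three mutually tangent circles is one that
  completes them to a Descartes configuration. There are two such circles, one for each of
  the two interstices.
\<close>

inductive_set packing_from :: "gcircle set \<Rightarrow> gcircle set" for D where
  initial: "x \<in> D \<Longrightarrow> x \<in> packing_from D"
| fill: "\<lbrakk>x \<in> packing_from D; y \<in> packing_from D; z \<in> packing_from D;
          descartes_config {x, y, z, w}\<rbrakk> \<Longrightarrow> w \<in> packing_from D"

definition apollonian_packing :: "gcircle set \<Rightarrow> bool" where
  "apollonian_packing P \<longleftrightarrow> (\<exists>D. descartes_config D \<and> P = packing_from D)"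

definition integral_packing :: "gcircle set \<Rightarrow> bool" where
  "integral_packing P \<longleftrightarrow> apollonian_packing P \<and> (\<forall>x\<in>P. curvature x \<in> \<int>)"

definition primitive_integral_packing :: "gcircle set \<Rightarrow> bool" where
  "primitive_integral_packing P \<longleftrightarrow> integral_packing P \<and>
     (\<forall>S. S \<subseteq> P \<and> descartes_config S \<longrightarrow>
        Gcd {k::int. real_of_int k \<in> curvature ` S} = 1)"

end

theory Submission
  imports Defs
begin

text \<open>
  Send a circle with chosen side to the vector of its curvature, its curvature times its centre,
  and the curvature of its image under inversion. Tangency with disjoint interiors becomes
  Lorentz product \<open>-1\<close> together with a sign condition, so the fourth circle of a Descartes
  configuration may be reflected linearly in the other three, and the Descartes equation is read off
  from the Gram matrix.

  Reflecting two circles alternately produces a chain of curvatures quadratic in its index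
  \<open>j\<close>. Modulo a prime power coprime to \<open>6\<close> every \<open>j\<close> is reached, and by the Chinese remainder
  theorem without moving the configuration modulo a coprime modulus; so prime powers may be treated
  one after the other. A residue \<open>r\<close> lies on the chain through circles touching those of curvatures
  \<open>c\<close> and \<open>d\<close> as soon as \<open>c (d + r) + d r\<close> is a nonzero square modulo \<open>p\<close>. After moving away
  from finitely many bad values, a point on a conic over the field of \<open>p\<close> elements gives a \<open>c\<close>
  with this property.
\<close>

section \<open>Circles as Lorentz vectors\<close>

text \<open>A line at distance \<open>\<bar>t\<bar>\<close> from the origin inverts to a circle of
  diameter \<open>1 / \<bar>t\<bar>\<close>, whence the value \<open>2 * t\<close>; a line through
  the origin stays a line, with value 0.\<close>

fun cocurvature :: "gcircle \<Rightarrow> real" where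
  "cocurvature (Disc c r) = (c \<bullet> c - r\<^sup>2) / r"
| "cocurvature (Enclosing c r) = - ((c \<bullet> c - r\<^sup>2) / r)"
| "cocurvature (HalfPlane n t) = 2 * t"

fun curved_center :: "gcircle \<Rightarrow> complex" where
  "curved_center (Disc c r) = c /\<^sub>R r"
| "curved_center (Enclosing c r) = - (c /\<^sub>R r)"
| "curved_center (HalfPlane n t) = n"

text \<open>The polar form of \<open>w \<bullet> w - b * b'\<close>, of signature (3,1). Circles are
  its unit vectors.\<close>

definition lorentz :: "gcircle \<Rightarrow> gcircle \<Rightarrow> real" where
  "lorentz x y = curved_center x \<bullet> curved_center y
     - (curvature x * cocurvature y + cocurvature x * curvature y) / 2"

text \<open>The classical power of a point times the signed curvature, or its limit for lines:
  linear in the vector of the circle and negative exactly on the interior.\<close>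

definition power_at :: "gcircle \<Rightarrow> complex \<Rightarrow> real" where
  "power_at x z = curvature x * (z \<bullet> z) - 2 * (curved_center x \<bullet> z) + cocurvature x"

definition touching :: "gcircle \<Rightarrow> gcircle \<Rightarrow> bool" where
  "touching x y \<longleftrightarrow> tangent x y \<and> gint x \<inter> gint y = {}"

section \<open>Circles and unit vectors\<close>

lemma power_at_Disc:
  assumes "r > 0"
  shows "power_at (Disc c r) z = ((dist c z)\<^sup>2 - r\<^sup>2) / r"
  using assms
  by (simp add: power_at_def dist_norm power2_norm_eq_inner inner_diff inner_commute field_simps)

lemma power_at_Enclosing: "power_at (Enclosing c r) z = - power_at (Disc c r) z"
  by (simp add: power_at_def)

lemma gint_power:
  assumes "is_gcircle x"
  shows "gint x = {z. power_at x z < 0}"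
proof -
  have less_iff: "s < t \<longleftrightarrow> s\<^sup>2 < t\<^sup>2" if "s \<ge> 0" "t \<ge> 0" for s t :: real
    using power_mono_iff[of t s 2] that by (simp add: not_le[symmetric])
  show ?thesis
  proof (cases x)
    case (Disc c r)
    with assms have r: "r > 0" by simp
    then have "dist c z < r \<longleftrightarrow> (dist c z)\<^sup>2 < r\<^sup>2" for z
      by (intro less_iff) auto
    with Disc r show ?thesis
      by (simp add: power_at_Disc divide_less_0_iff set_eq_iff)
  next
    case (Enclosing c r)
    with assms have r: "r > 0" by simp
    then have "r < dist c z \<longleftrightarrow> r\<^sup>2 < (dist c z)\<^sup>2" for z
      by (intro less_iff) auto
    with Enclosing r show ?thesis
      by (simp add: power_at_Enclosing power_at_Disc zero_less_divide_iff set_eq_iff not_le)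
  next
    case (HalfPlane n t)
    then show ?thesis by (auto simp: power_at_def)
  qed
qed

lemma gpoints_power:
  assumes "is_gcircle x"
  shows "gpoints x = Some ` {z. power_at x z = 0} \<union> (if curvature x = 0 then {None} else {})"
proof -
  have "dist c z = r \<longleftrightarrow> (dist c z)\<^sup>2 = r\<^sup>2" if "r > 0" for c z :: complex and r
    using that by simp
  then have "sphere c r = {z. power_at (Disc c r) z = 0}" if "r > 0" for c r
    using that by (auto simp: power_at_Disc)
  with assms show ?thesis
    by (cases x) (auto simp: power_at_Enclosing, auto simp: power_at_def)
qed

lemma lorentz_self:
  assumes "is_gcircle x"
  shows "lorentz x x = 1"
  using assms
  by (cases x) (auto simp: lorentz_def field_simps power2_eq_square norm_eq_1)

lemma lorentz_commute: "lorentz x y = lorentz y x"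
  by (simp add: lorentz_def inner_commute mult.commute add.commute)

text \<open>Turns a vector computed linearly back into a circle: the sign of \<open>b\<close>
  selects its kind, and for nonzero \<open>b\<close> the centre is
  \<open>w /\<^sub>R b\<close>.\<close>

lemma exists_gcircle:
  assumes "w \<bullet> w - b * b' = 1"
  obtains x where "is_gcircle x" "curvature x = b" "cocurvature x = b'" "curved_center x = w"
proof (cases b "0::real" rule: linorder_cases)
  case less
  let ?x = "Enclosing (w /\<^sub>R b) (- 1 / b)"
  have "cocurvature ?x = b'"
    using less assms by (simp add: field_simps power2_eq_square)
  with less show ?thesis by (intro that[of ?x]) (auto simp: field_simps)
next
  case equal
  with assms show ?thesis
    by (intro that[of "HalfPlane w (b' / 2)"]) (auto simp: norm_eq_1)
next
  case greater
  let ?x = "Disc (w /\<^sub>R b) (1 / b)"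
  have "cocurvature ?x = b'"
    using greater assms by (simp add: field_simps power2_eq_square)
  with greater show ?thesis by (intro that[of ?x]) (auto simp: field_simps)
qed

section \<open>Tangency and the Lorentz product\<close>

lemma null_nonneg:
  fixes b b' :: real and w :: complex
  assumes "w \<bullet> w = b * b'" "b + b' > 0"
  shows "b \<ge> 0" "b' \<ge> 0"
proof -
  have "b * b' \<ge> 0" using assms(1) by (metis inner_ge_zero)
  then show "b \<ge> 0" "b' \<ge> 0" using assms(2) by (auto simp: zero_le_mult_iff)
qed

text \<open>Null vectors on the same nappe of the light cone have nonpositive Lorentz product, by
  Cauchy-Schwarz and the inequality of means.\<close>

lemma null_inner_nonpos:
  fixes v w :: complex
  assumes v: "v \<bullet> v = a * a'" "a + a' > 0" and w: "w \<bullet> w = b * b'" "b + b' > 0"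
  shows "v \<bullet> w \<le> (a * b' + a' * b) / 2"
proof -
  note nn = null_nonneg[OF v] null_nonneg[OF w]
  have "(v \<bullet> w)\<^sup>2 \<le> (v \<bullet> v) * (w \<bullet> w)" by (rule Cauchy_Schwarz_ineq)
  also have "\<dots> = (a * b') * (a' * b)" using v w by simp
  also have "\<dots> \<le> ((a * b' + a' * b) / 2)\<^sup>2"
    using zero_le_power2[of "a * b' - a' * b"] by (simp add: power2_eq_square field_simps)
  finally show ?thesis by (rule power2_le_imp_le) (use nn in simp)
qed

text \<open>The sum \<open>(B, W, B')\<close> of the two vectors is null. So \<open>B\<close> times
  the sum of the powers at \<open>z\<close> is the square of the norm of
  \<open>B *\<^sub>R z - W\<close>: the powers are never both negative, and both vanish at most at
  \<open>W /\<^sub>R B\<close>. For \<open>B = 0\<close> the common point is at infinity.\<close>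

lemma touching_if_lorentz:
  assumes x: "is_gcircle x" and y: "is_gcircle y" and xy: "lorentz x y = -1"
    and pos: "curvature x + curvature y + (cocurvature x + cocurvature y) > 0"
  shows "touching x y"
proof -
  define B where "B = curvature x + curvature y"
  define B' where "B' = cocurvature x + cocurvature y"
  define W where "W = curved_center x + curved_center y"
  note xx = lorentz_self[OF x] and yy = lorentz_self[OF y]
  have WW: "W \<bullet> W = B * B'"
    using xx yy xy unfolding lorentz_def W_def B_def B'_def
    by (simp add: algebra_simps inner_commute)
  have nn: "B \<ge> 0" "B' \<ge> 0" using null_nonneg[OF WW] pos by (auto simp: B_def B'_def)
  have xW: "curved_center x \<bullet> W = (curvature x * B' + cocurvature x * B) / 2"
    using xx xy unfolding lorentz_def W_def B_def B'_def
    by (simp add: algebra_simps)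
  have sum: "power_at x z + power_at y z = B * (z \<bullet> z) - 2 * (W \<bullet> z) + B'" for z
    unfolding power_at_def W_def B_def B'_def by (simp add: algebra_simps)
  have sumB: "B * (power_at x z + power_at y z) = (B *\<^sub>R z - W) \<bullet> (B *\<^sub>R z - W)" for z
    unfolding sum by (simp add: inner_commute WW algebra_simps)
  have sum_nonneg: "power_at x z + power_at y z \<ge> 0" for z
  proof (cases "B = 0")
    case True
    then show ?thesis using WW nn by (simp add: sum)
  next
    case False
    with nn have "B > 0" by simp
    moreover have "B * (power_at x z + power_at y z) \<ge> 0" by (simp only: sumB inner_ge_zero)
    ultimately show ?thesis by (simp add: zero_le_mult_iff)
  qed
  have "\<not> (power_at x z < 0 \<and> power_at y z < 0)" for z
    using sum_nonneg[of z] by linarith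
  then have disj: "gint x \<inter> gint y = {}"
    unfolding gint_power[OF x] gint_power[OF y] by auto
  have "tangent x y"
  proof (cases "B = 0")
    case True
    then have "W = 0" and "B' > 0" using WW pos by (auto simp: B_def B'_def)
    with True xW have "curvature x = 0" by simp
    moreover with True have "curvature y = 0" by (simp add: B_def)
    moreover have "\<not> (power_at x z = 0 \<and> power_at y z = 0)" for z
      using sum[of z] True \<open>W = 0\<close> \<open>B' > 0\<close> by auto
    ultimately show ?thesis
      unfolding tangent_def gpoints_power[OF x] gpoints_power[OF y] by auto
  next
    case False
    with nn have "B > 0" by simp
    define p where "p = W /\<^sub>R B"
    have "B * power_at x p = 0" "power_at x p + power_at y p = 0"
      using \<open>B > 0\<close> xW unfolding sum unfolding power_at_def p_def
      by (simp_all add: WW field_simps power2_eq_square)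
    with \<open>B > 0\<close> have "power_at x p = 0" "power_at y p = 0" by auto
    moreover have "z = p" if "power_at x z = 0" "power_at y z = 0" for z
      using sumB[of z] that \<open>B > 0\<close> by (auto simp: p_def)
    moreover have "\<not> (curvature x = 0 \<and> curvature y = 0)"
      using False by (auto simp: B_def)
    ultimately show ?thesis
      unfolding tangent_def gpoints_power[OF x] gpoints_power[OF y] by auto
  qed
  with disj show ?thesis by (simp add: touching_def)
qed

lemma unit_opposite:
  fixes u v :: complex
  assumes "u \<bullet> u = 1" "v \<bullet> v = 1" "1 + u \<bullet> v \<le> 0"
  shows "v = - u"
proof -
  have "(u + v) \<bullet> (u + v) \<le> 0" using assms by (simp add: inner_add inner_commute)
  then have "u + v = 0" by (metis inner_eq_zero_iff inner_ge_zero order_antisym)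
  then show ?thesis by (simp add: eq_neg_iff_add_eq_0 add.commute)
qed

text \<open>At the common point, finite or infinite, disjointness forces opposite inner normals,
  which is the product -1. The sign then follows because otherwise the interiors overlap or a second
  common point exists.\<close>

lemma lorentz_if_touching:
  assumes x: "is_gcircle x" and y: "is_gcircle y" and xy: "touching x y"
  shows "lorentz x y = -1"
    and "curvature x + curvature y + (cocurvature x + cocurvature y) > 0"
proof -
  define b where "b = curvature x"
  define b' where "b' = cocurvature x"
  define w where "w = curved_center x"
  define c where "c = curvature y"
  define c' where "c' = cocurvature y"
  define v where "v = curved_center y"
  note defs = b_def b'_def w_def c_def c'_def v_def
  have px: "power_at x z = b * (z \<bullet> z) - 2 * (w \<bullet> z) + b'" for z
    by (simp add: power_at_def defs)
  have py: "power_at y z = c * (z \<bullet> z) - 2 * (v \<bullet> z) + c'" for z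
    by (simp add: power_at_def defs)
  have ww: "w \<bullet> w = 1 + b * b'" and vv: "v \<bullet> v = 1 + c * c'"
    using lorentz_self[OF x] lorentz_self[OF y] by (simp_all add: lorentz_def defs)
  have lor: "lorentz x y = w \<bullet> v - (b * c' + b' * c) / 2"
    by (simp add: lorentz_def defs)
  have disj: "\<not> (power_at x z < 0 \<and> power_at y z < 0)" for z
    using xy unfolding touching_def gint_power[OF x] gint_power[OF y] by auto
  have uniq: "z = z'" if "power_at x z = 0" "power_at y z = 0"
      "power_at x z' = 0" "power_at y z' = 0" for z z'
    using xy that unfolding touching_def tangent_def gpoints_power[OF x] gpoints_power[OF y]
    by auto
  have uniq_inf: False if "power_at x z = 0" "power_at y z = 0" "b = 0" "c = 0" for z
    using xy that unfolding touching_def tangent_def gpoints_power[OF x] gpoints_power[OF y] defs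
    by auto
  obtain q where q: "q \<in> gpoints x" "q \<in> gpoints y"
    using xy unfolding touching_def tangent_def by blast
  have "lorentz x y = -1 \<and> b + c + (b' + c') > 0"
  proof (cases q)
    case None
    then have b0: "b = 0" and c0: "c = 0"
      using q unfolding gpoints_power[OF x] gpoints_power[OF y] defs by (auto split: if_splits)
    have "1 + w \<bullet> v \<le> 0"
      \<comment> \<open>otherwise the interiors meet far out in the direction of \<open>w + v\<close>\<close>
    proof (rule ccontr)
      assume "\<not> ?thesis"
      then have pos: "1 + w \<bullet> v > 0" by simp
      define s where "s = (\<bar>b'\<bar> + \<bar>c'\<bar> + 1) / (1 + w \<bullet> v)"
      have "s * (1 + w \<bullet> v) = \<bar>b'\<bar> + \<bar>c'\<bar> + 1" using pos by (simp add: s_def)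
      then have "power_at x (s *\<^sub>R (w + v)) = b' - 2 * (\<bar>b'\<bar> + \<bar>c'\<bar> + 1)"
        "power_at y (s *\<^sub>R (w + v)) = c' - 2 * (\<bar>b'\<bar> + \<bar>c'\<bar> + 1)"
        using ww vv b0 c0 by (simp_all add: px py inner_commute algebra_simps)
      then have "power_at x (s *\<^sub>R (w + v)) < 0 \<and> power_at y (s *\<^sub>R (w + v)) < 0"
        by auto
      with disj show False by blast
    qed
    with ww vv b0 c0 have vw: "v = - w" by (intro unit_opposite) auto
    \<comment> \<open>On the common normal of the two parallel lines, this is the point where both
      powers agree.\<close>
    define z where "z = ((b' - c') / 4) *\<^sub>R w"
    have zx: "power_at x z = (b' + c') / 2" and zy: "power_at y z = (b' + c') / 2"
      using ww b0 c0 vw by (simp_all add: px py z_def field_simps)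
    have "b' + c' \<noteq> 0" using uniq_inf[of z] zx zy b0 c0 by auto
    moreover have "\<not> b' + c' < 0" using disj[of z] zx zy by auto
    ultimately show ?thesis using ww b0 c0 vw by (simp add: lor)
  next
    case (Some p)
    then have p0: "power_at x p = 0" "power_at y p = 0"
      using q unfolding gpoints_power[OF x] gpoints_power[OF y] by (auto split: if_splits)
    define M where "M = w - b *\<^sub>R p"
    define N where "N = v - c *\<^sub>R p"
    have w_eq: "w = M + b *\<^sub>R p" and v_eq: "v = N + c *\<^sub>R p" by (simp_all add: M_def N_def)
    have b'_eq: "b' = 2 * (M \<bullet> p) + b * (p \<bullet> p)" and c'_eq: "c' = 2 * (N \<bullet> p) + c * (p \<bullet> p)"
      using p0 by (simp_all add: px py w_eq v_eq algebra_simps)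
    have MM: "M \<bullet> M = 1" and NN: "N \<bullet> N = 1"
      using ww vv by (simp_all add: w_eq v_eq b'_eq c'_eq inner_commute algebra_simps)
    have shift_x: "power_at x (p + h) = b * (h \<bullet> h) - 2 * (M \<bullet> h)" for h
      by (simp add: px w_eq b'_eq inner_commute algebra_simps)
    have shift_y: "power_at y (p + h) = c * (h \<bullet> h) - 2 * (N \<bullet> h)" for h
      by (simp add: py v_eq c'_eq inner_commute algebra_simps)
    have "1 + M \<bullet> N \<le> 0"
      \<comment> \<open>\<open>M\<close> and \<open>N\<close> are the inner unit normals at \<open>p\<close>; otherwise the interiors meet near \<open>p\<close>
        in the direction of \<open>M + N\<close>\<close>
    proof (rule ccontr)
      assume "\<not> ?thesis"
      then have pos: "1 + M \<bullet> N > 0" by simp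
      define e where "e = 1 / (1 + \<bar>b\<bar> + \<bar>c\<bar>)"
      have e: "e > 0" "e * b < 1" "e * c < 1" by (auto simp: e_def field_simps)
      define k where "k = e * (1 + M \<bullet> N)"
      have k: "k > 0" using e pos by (simp add: k_def)
      have sq: "(e *\<^sub>R (M + N)) \<bullet> (e *\<^sub>R (M + N)) = 2 * e * k"
        "M \<bullet> (e *\<^sub>R (M + N)) = k" "N \<bullet> (e *\<^sub>R (M + N)) = k"
        using MM NN by (simp_all add: k_def inner_commute algebra_simps)
      have "2 * k * (e * b) < 2 * k" "2 * k * (e * c) < 2 * k" using e k by simp_all
      then have "power_at x (p + e *\<^sub>R (M + N)) < 0 \<and> power_at y (p + e *\<^sub>R (M + N)) < 0"
        unfolding shift_x shift_y sq by (simp add: mult_ac)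
      with disj show False by blast
    qed
    with MM NN have NM: "N = - M" by (intro unit_opposite) auto
    have "b + c > 0"
    proof (rule ccontr)
      assume le: "\<not> b + c > 0"
      \<comment> \<open>\<open>p + h\<close> lies on the circle through \<open>p\<close> with normal \<open>M\<close> whose curvature \<open>\<mu>\<close> is midway between
        those of the two circles, seen from the same side\<close>
      define \<mu> where "\<mu> = (b - c) / 2"
      define h where "h = (if \<mu> = 0 then \<i> * M else (2 / \<mu>) *\<^sub>R M)"
      have M0: "M \<noteq> 0" using MM by auto
      have h0: "h \<noteq> 0" using M0 by (simp add: h_def)
      then have hh: "h \<bullet> h > 0" by simp
      have Mh: "2 * (M \<bullet> h) = \<mu> * (h \<bullet> h)"
      proof (cases "\<mu> = 0")
        case True
        then show ?thesis by (simp add: h_def inner_complex_def)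
      next
        case False
        then show ?thesis using MM by (simp add: h_def)
      qed
      have hx: "power_at x (p + h) = (b + c) / 2 * (h \<bullet> h)"
        and hy: "power_at y (p + h) = (b + c) / 2 * (h \<bullet> h)"
        unfolding shift_x shift_y NM using Mh by (simp_all add: \<mu>_def field_simps)
      show False
      proof (cases "b + c = 0")
        case True
        then show False using uniq[of p "p + h"] p0 hx hy h0 by simp
      next
        case False
        then have "(b + c) / 2 * (h \<bullet> h) < 0" using le hh by (intro mult_neg_pos) auto
        then show False using disj[of "p + h"] hx hy by simp
      qed
    qed
    moreover have "b' + c' = (b + c) * (p \<bullet> p)" by (simp add: b'_eq c'_eq NM algebra_simps)
    moreover have "lorentz x y = -1"
      unfolding lor using MM by (simp add: w_eq v_eq b'_eq c'_eq NM inner_commute algebra_simps diff_divide_distrib add_divide_distrib)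
    ultimately show ?thesis by (simp add: add_pos_nonneg)
  qed
  then show "lorentz x y = -1" "curvature x + curvature y + (cocurvature x + cocurvature y) > 0"
    by (simp_all add: defs)
qed

section \<open>Descartes configurations: reflection and the Descartes equation\<close>

lemma touching_commute: "touching x y \<longleftrightarrow> touching y x"
  by (simp add: touching_def tangent_def Int_commute)

lemma touching_irrefl:
  assumes "is_gcircle x"
  shows "\<not> touching x x"
  using lorentz_if_touching(1)[of x x] lorentz_self[OF assms] assms by auto

lemma descartes_config_iff:
  "descartes_config {x, y, z, w} \<longleftrightarrow>
     is_gcircle x \<and> is_gcircle y \<and> is_gcircle z \<and> is_gcircle w \<and>
     touching x y \<and> touching x z \<and> touching x w \<and> touching y z \<and> touching y w \<and> touching z w"
  (is "?L \<longleftrightarrow> ?R")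
proof
  assume L: ?L
  then have "card {x, y, z, w} = 4" by (simp add: descartes_config_def)
  then have "distinct [x, y, z, w]"
    by (intro card_distinct) simp
  with L show ?R
    by (auto simp: descartes_config_def pairwise_def touching_def)
next
  assume R: ?R
  then have "distinct [x, y, z, w]" using touching_irrefl by auto
  moreover from R have "touching y x" "touching z x" "touching w x" "touching z y" "touching w y" "touching w z"
    using touching_commute by blast+
  ultimately show ?L using R
    by (auto simp: descartes_config_def pairwise_def touching_def)
qed

text \<open>The vector \<open>2 (y + z + w) - x\<close> is the Lorentz reflection of
  \<open>x\<close> in the hyperplane spanned by \<open>y\<close>, \<open>z\<close>,
  \<open>w\<close>, so it keeps norm 1 and the products -1.\<close>

lemma reflected_circle:
  assumes "descartes_config {x, y, z, w}"
  obtains x' where "descartes_config {y, z, w, x'}"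
    and "curvature x' = 2 * (curvature y + curvature z + curvature w) - curvature x"
proof -
  have g: "is_gcircle x" "is_gcircle y" "is_gcircle z" "is_gcircle w"
    and t: "touching x y" "touching x z" "touching x w" "touching y z" "touching y w" "touching z w"
    using assms unfolding descartes_config_iff by auto
  note self = g[THEN lorentz_self]
  note lors = lorentz_if_touching(1)[OF g(1) g(2) t(1)] lorentz_if_touching(1)[OF g(1) g(3) t(2)]
    lorentz_if_touching(1)[OF g(1) g(4) t(3)] lorentz_if_touching(1)[OF g(2) g(3) t(4)]
    lorentz_if_touching(1)[OF g(2) g(4) t(5)] lorentz_if_touching(1)[OF g(3) g(4) t(6)]
  let ?v = "2 *\<^sub>R (curved_center y + curved_center z + curved_center w) - curved_center x"
  let ?b = "2 * (curvature y + curvature z + curvature w) - curvature x"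
  let ?b' = "2 * (cocurvature y + cocurvature z + cocurvature w) - cocurvature x"
  have "?v \<bullet> ?v - ?b * ?b' = 
    4 * (lorentz y y + lorentz z z + lorentz w w) + lorentz x x
    + 8 * (lorentz y z + lorentz y w + lorentz z w) - 4 * (lorentz x y + lorentz x z + lorentz x w)"
    unfolding lorentz_def by (simp add: inner_commute algebra_simps add_divide_distrib)
  also have "\<dots> = 1" using self lors by simp
  finally obtain x' where x': "is_gcircle x'" "curvature x' = ?b" "cocurvature x' = ?b'" "curved_center x' = ?v"
    by (rule exists_gcircle)
  have lor': "lorentz u x' = 2 * (lorentz u y + lorentz u z + lorentz u w) - lorentz u x" for u
    unfolding lorentz_def x' by (simp add: algebra_simps add_divide_distrib diff_divide_distrib)
  \<comment> \<open>Only the sign condition is at stake. The null vectors \<open>u + u'\<close> and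
    \<open>u + x'\<close> have product 1 - 1 - 1 - 1 = -2. If \<open>u + x'\<close> had negative
    sign, its negative would lie on the nappe of \<open>u + u'\<close> and have product 2 with it,
    which is impossible; with sign zero it would vanish.\<close>
  have touch: "touching u x'"
    if u: "is_gcircle u" "is_gcircle u'" "touching u u'" "lorentz u x' = -1" "lorentz u' x' = -1"
      for u u'
  proof (rule touching_if_lorentz)
    show "lorentz u x' = -1" by fact
    show "is_gcircle u" "is_gcircle x'" by fact+
    note uu' = lorentz_if_touching[OF u(1,2,3)]
    have n1: "(curved_center u + curved_center u') \<bullet> (curved_center u + curved_center u')
        = (curvature u + curvature u') * (cocurvature u + cocurvature u')"
      using lorentz_self[OF u(1)] lorentz_self[OF u(2)] uu'(1) unfolding lorentz_def
      by (simp add: inner_commute algebra_simps)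
    have n2: "(- (curved_center u + curved_center x')) \<bullet> (- (curved_center u + curved_center x'))
        = (- (curvature u + curvature x')) * (- (cocurvature u + cocurvature x'))"
      using lorentz_self[OF u(1)] lorentz_self[OF x'(1)] u(4) unfolding lorentz_def
      by (simp add: inner_commute algebra_simps)
    show "curvature u + curvature x' + (cocurvature u + cocurvature x') > 0"
    proof (rule ccontr)
      assume nonpos: "\<not> ?thesis"
      have "lorentz u u + lorentz u u' + lorentz u x' + lorentz u' x' = -2"
        using lorentz_self[OF u(1)] uu'(1) u(4,5) by simp
      then have neg: "(curved_center u + curved_center u') \<bullet> (curved_center u + curved_center x') - 
         ((curvature u + curvature u') * (cocurvature u + cocurvature x') 
        + (cocurvature u + cocurvature u') * (curvature u + curvature x')) / 2 = - 2"
        unfolding lorentz_def by (simp add: inner_commute algebra_simps add_divide_distrib)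
      show False
      proof (cases "curvature u + curvature x' + (cocurvature u + cocurvature x') = 0")
        case True
        then have e: "cocurvature u + cocurvature x' = - (curvature u + curvature x')" by simp
        have "(curvature u + curvature x') * (curvature u + curvature x') = 0 \<and> curved_center u + curved_center x' = 0"
          using n2 unfolding e
          by (metis (no_types, lifting) add.inverse_inverse inner_ge_zero inner_eq_zero_iff
              inner_minus_left inner_minus_right linorder_not_less mult_minus_left neg_0_less_iff_less
              neg_le_0_iff_le order_antisym zero_le_square)
        then show False using neg e by auto
      next
        case False
        with nonpos have "- (curvature u + curvature x') + - (cocurvature u + cocurvature x') > 0" by simp
        from null_inner_nonpos[OF n1 _ n2 this] uu'(2) neg show False
          by (simp add: algebra_simps)
      qed
    qed
  qed
  have "lorentz y x' = -1" "lorentz z x' = -1" "lorentz w x' = -1"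
    unfolding lor' using self lors by (simp_all add: lorentz_commute)
  then have "touching y x'" "touching z x'" "touching w x'"
    using touch[of y z] touch[of z w] touch[of w y] g t touching_commute by auto
  with g t x' have "descartes_config {y, z, w, x'}" by (simp add: descartes_config_iff)
  then show ?thesis using x'(2) by (rule that)
qed

text \<open>With \<open>G = 2 I - J\<close> the Gram matrix of the configuration, \<open>U Q U\<^sup>T = G\<close>
  gives \<open>U\<^sup>T G\<^sup>-\<^sup>1 U = Q\<^sup>-\<^sup>1\<close>, whose entry at the two curvature coordinates is zero;
  here \<open>G\<^sup>-\<^sup>1 = I / 2 - J / 4\<close>.\<close>

lemma descartes_equation:
  assumes "descartes_config {x, y, z, w}"
  shows "2 * ((curvature x)\<^sup>2 + (curvature y)\<^sup>2 + (curvature z)\<^sup>2 + (curvature w)\<^sup>2)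
    = (curvature x + curvature y + curvature z + curvature w)\<^sup>2"
proof -
  have g: "is_gcircle x" "is_gcircle y" "is_gcircle z" "is_gcircle w"
    and t: "touching x y" "touching x z" "touching x w" "touching y z" "touching y w" "touching z w"
    using assms unfolding descartes_config_iff by auto
  note self = g[THEN lorentz_self]
  note lors = lorentz_if_touching(1)[OF g(1) g(2) t(1)] lorentz_if_touching(1)[OF g(1) g(3) t(2)]
    lorentz_if_touching(1)[OF g(1) g(4) t(3)] lorentz_if_touching(1)[OF g(2) g(3) t(4)]
    lorentz_if_touching(1)[OF g(2) g(4) t(5)] lorentz_if_touching(1)[OF g(3) g(4) t(6)]
  define row :: "gcircle \<Rightarrow> real^4" where
    "row u = (\<chi> k. if k = 1 then curvature u else if k = 2 then cocurvature u
      else if k = 3 then Re (curved_center u) else Im (curved_center u))" for u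
  define dual :: "gcircle \<Rightarrow> real^4" where
    "dual u = (\<chi> k. if k = 1 then - cocurvature u / 2 else if k = 2 then - curvature u / 2
      else if k = 3 then Re (curved_center u) else Im (curved_center u))" for u
  define C :: "4 \<Rightarrow> gcircle" where "C i = (if i = 1 then x else if i = 2 then y else if i = 3 then z else w)" for i
  define U :: "real^4^4" where "U = (\<chi> i. row (C i))"
  define S :: "real^4" where "S = (\<Sum>i\<in>UNIV. dual (C i))"
  \<comment> \<open>\<open>V\<close> is \<open>Q U\<^sup>T G\<^sup>-\<^sup>1\<close>, a right
    inverse of \<open>U\<close>, hence also a left inverse; entry (2,1) of \<open>V ** U\<close>
    involves curvatures only.\<close>
  define V :: "real^4^4" where "V = (\<chi> k j. dual (C j) $ k / 2 - S $ k / 4)"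
  have lor: "(\<Sum>k\<in>UNIV. row u $ k * dual v $ k) = lorentz u v" for u v
    by (simp add: sum_4 row_def dual_def lorentz_def inner_complex_def field_simps)
  have "(U ** V) $ i $ j = lorentz (C i) (C j) / 2 - (\<Sum>l\<in>UNIV. lorentz (C i) (C l)) / 4" for i j
    unfolding matrix_matrix_mult_def U_def V_def S_def lor[symmetric]
    by (simp add: sum_4 algebra_simps add_divide_distrib)
  moreover have "lorentz (C i) (C j) = (if i = j then 1 else - 1)" for i j
    using self lors exhaust_4[of i] exhaust_4[of j] by (auto simp: C_def lorentz_commute)
  ultimately have "U ** V = mat 1"
    by (simp add: vec_eq_iff forall_4 mat_def sum_4)
  then have "V ** U = mat 1" by (simp add: matrix_left_right_inverse)
  then have "(V ** U) $ 2 $ 1 = 0" by (simp add: mat_def)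
  then show ?thesis
    by (simp add: matrix_matrix_mult_def U_def V_def S_def sum_4 C_def row_def dual_def
        power2_eq_square field_simps)
qed

section \<open>Quadratic congruences\<close>

lemma prime_not_dvd_small:
  fixes p :: int
  assumes "prime p" "p > 3"
  shows "\<not> p dvd 2" "\<not> p dvd 3" "\<not> p dvd 4" "\<not> p dvd 24"
proof -
  show p2: "\<not> p dvd 2" and p3: "\<not> p dvd 3"
    using assms(2) by (auto dest: zdvd_imp_le)
  show "\<not> p dvd 4"
    using p2 prime_dvd_mult_iff[OF assms(1), of 2 2] by simp
  then show "\<not> p dvd 24"
    using p2 p3 prime_dvd_mult_iff[OF assms(1), of 4 6] prime_dvd_mult_iff[OF assms(1), of 2 3] by simp
qed

lemma prime_inverse_mod:
  fixes p a :: int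
  assumes "prime p" "\<not> p dvd a"
  obtains z where "p dvd a * z - 1"
proof -
  have "coprime a p" using assms prime_imp_coprime coprime_commute by blast
  then obtain z where "[a * z = 1] (mod p)" using cong_solve_coprime_int by blast
  then show ?thesis using that by (simp add: cong_iff_dvd_diff)
qed

text \<open>Pigeonhole: \<open>x\<^sup>2\<close> and \<open>A * y\<^sup>2 + D\<close> each take
  \<open>(p + 1) / 2\<close> values on \<open>S\<close>, too many to be disjoint modulo
  \<open>p\<close>.\<close>

lemma ex_diff_square_scaled_square:
  fixes p A D :: int
  assumes p: "prime p" "p > 3" and A: "\<not> p dvd A"
  shows "\<exists>x y. p dvd x\<^sup>2 - A * y\<^sup>2 - D"
proof -
  define S where "S = {0..(p - 1) div 2}"
  have sq: "x = y" if "x \<in> S" "y \<in> S" "p dvd x\<^sup>2 - y\<^sup>2" for x y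
  proof -
    have "p dvd (x - y) * (x + y)" using that(3) by (simp add: power2_eq_square algebra_simps)
    then consider "p dvd x - y" | "p dvd x + y" using p prime_dvd_multD by blast
    then show ?thesis
    proof cases
      case 1
      have "\<bar>x - y\<bar> < \<bar>p\<bar>" using that p by (auto simp: S_def)
      with 1 show ?thesis using dvd_imp_le_int[of "x - y" p] by fastforce
    next
      case 2
      have "0 \<le> x" "0 \<le> y" "\<bar>x + y\<bar> < \<bar>p\<bar>" using that p by (auto simp: S_def)
      with 2 show ?thesis using dvd_imp_le_int[of "x + y" p] by fastforce
    qed
  qed
  define f where "f x = x\<^sup>2 mod p" for x
  define g where "g y = (A * y\<^sup>2 + D) mod p" for y
  have f: "inj_on f S"
    by (rule inj_onI) (auto simp: f_def mod_eq_dvd_iff intro: sq)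
  have "p dvd x\<^sup>2 - y\<^sup>2" if "g x = g y" for x y
  proof -
    have "p dvd (A * x\<^sup>2 + D) - (A * y\<^sup>2 + D)" using that by (simp add: g_def mod_eq_dvd_iff)
    then have "p dvd A * (x\<^sup>2 - y\<^sup>2)" by (simp add: algebra_simps)
    then show ?thesis using A p prime_dvd_multD by blast
  qed
  then have g: "inj_on g S" by (auto intro!: inj_onI sq)
  have "f ` S \<inter> g ` S \<noteq> {}"
  proof
    assume "f ` S \<inter> g ` S = {}"
    then have "card (f ` S \<union> g ` S) = 2 * card S"
      using f g by (subst card_Un_disjoint) (auto simp: S_def card_image)
    moreover have "f ` S \<union> g ` S \<subseteq> {0..<p}" using p by (auto simp: f_def g_def)
    then have "card (f ` S \<union> g ` S) \<le> card {0..<p}" by (intro card_mono) auto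
    moreover have "odd p" using p prime_odd_int by fastforce
    ultimately show False using p by (auto simp: S_def elim!: oddE)
  qed
  then obtain x y where "f x = g y" by blast
  then show ?thesis
    by (intro exI[of _ x] exI[of _ y]) (simp add: f_def g_def mod_eq_dvd_iff algebra_simps)
qed

text \<open>If the point found above lies on \<open>U = 0\<close>, intersect the conic with another line
  through it, of slope \<open>1\<close> or \<open>2\<close>; since \<open>p > 3\<close>, one of these lines is not asymptotic.\<close>

lemma ex_conic_point:
  fixes p A D :: int
  assumes p: "prime p" "p > 3" and A: "\<not> p dvd A" and D: "\<not> p dvd D"
  shows "\<exists>X U. \<not> p dvd U \<and> p dvd X\<^sup>2 - A * U\<^sup>2 - D"
proof -
  obtain X U where XU: "p dvd X\<^sup>2 - A * U\<^sup>2 - D"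
    using ex_diff_square_scaled_square[OF p A] by blast
  show ?thesis
  proof (cases "p dvd U")
    case False
    with XU show ?thesis by blast
  next
    case True
    then have "p dvd A * U\<^sup>2" by (simp add: power2_eq_square)
    from dvd_add[OF XU this] have X: "p dvd X\<^sup>2 - D" by simp
    have pX: "\<not> p dvd X"
    proof
      assume "p dvd X"
      then have "p dvd X\<^sup>2" by (simp add: power2_eq_square)
      from dvd_diff[OF this X] D show False by simp
    qed
    obtain t :: int where t: "\<not> p dvd 1 - A * t\<^sup>2" "\<not> p dvd t"
    proof (cases "p dvd 1 - A")
      case True
      have "\<not> p dvd 1 - A * 2\<^sup>2"
      proof
        assume "p dvd 1 - A * 2\<^sup>2"
        from dvd_diff[OF dvd_mult[OF True, of 4] this] have "p dvd 3" by simp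
        with prime_not_dvd_small[OF p] show False by simp
      qed
      with prime_not_dvd_small[OF p] that[of 2] show ?thesis by blast
    next
      case False
      have "\<not> p dvd 1" using p not_prime_unit by auto
      with False that[of 1] show ?thesis by simp
    qed
    from t(1) obtain z where z: "p dvd (1 - A * t\<^sup>2) * z - 1" using prime_inverse_mod[OF p(1)] by blast
    have pz: "\<not> p dvd z"
    proof
      assume "p dvd z"
      then have "p dvd (1 - A * t\<^sup>2) * z" by simp
      from dvd_diff[OF this z] have "p dvd 1" by simp
      then show False using p not_prime_unit by auto
    qed
    \<comment> \<open>Modulo \<open>p\<close>, this is the second intersection of the conic with the
      line \<open>U' = t * (X' + X)\<close> through its point \<open>(-X, 0)\<close>.\<close>
    define X' where "X' = X * (1 + A * t\<^sup>2) * z"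
    define U' where "U' = 2 * t * X * z"
    have "\<not> p dvd U'"
      using pX pz t prime_not_dvd_small[OF p] p by (simp add: U'_def prime_dvd_mult_iff)
    moreover have "X'\<^sup>2 - A * U'\<^sup>2 - D
        = ((1 - A * t\<^sup>2) * z - 1) * (((1 - A * t\<^sup>2) * z + 1) * X\<^sup>2) + (X\<^sup>2 - D)"
      unfolding X'_def U'_def by algebra
    then have "p dvd X'\<^sup>2 - A * U'\<^sup>2 - D" using z X by (metis dvd_add dvd_mult2)
    ultimately show ?thesis by blast
  qed
qed

text \<open>Completing the square, with \<open>X = 2 * A * j + B\<close> and
  \<open>U = 2 * u\<close>, turns the claim into a point with \<open>U\<close> nonzero on the conic
  of \<open>ex_conic_point\<close>.\<close>

lemma quadratic_takes_square:
  fixes p A B C :: int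
  assumes p: "prime p" "p > 3" and A: "\<not> p dvd A" and disc: "\<not> p dvd B\<^sup>2 - 4 * A * C"
  shows "\<exists>j u. \<not> p dvd u \<and> p dvd A * j\<^sup>2 + B * j + C - u\<^sup>2"
proof -
  obtain X U where U: "\<not> p dvd U" and XU: "p dvd X\<^sup>2 - A * U\<^sup>2 - (B\<^sup>2 - 4 * A * C)"
    using ex_conic_point[OF p A disc] by blast
  have A2: "\<not> p dvd 2 * A" and A4: "\<not> p dvd 4 * A"
    using A prime_not_dvd_small[OF p] p by (simp_all add: prime_dvd_mult_iff)
  obtain z where z: "p dvd 2 * A * z - 1" using prime_inverse_mod[OF p(1) A2] by blast
  obtain h where h: "p dvd 2 * h - 1" using prime_inverse_mod[OF p(1) prime_not_dvd_small(1)[OF p]] by blast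
  define j where "j = (X - B) * z"
  define u where "u = U * h"
  have "\<not> p dvd h"
  proof
    assume "p dvd h"
    then have "p dvd 2 * h" by simp
    from dvd_diff[OF this h] have "p dvd 1" by simp
    then show False using p not_prime_unit by auto
  qed
  then have "\<not> p dvd u" using U p by (simp add: u_def prime_dvd_mult_iff)
  moreover have "4 * A * (A * j\<^sup>2 + B * j + C - u\<^sup>2) =
      (2 * A * z - 1) * ((X - B) * (2 * A * j + B + X)) - (2 * h - 1) * (A * U\<^sup>2 * (2 * h + 1))
      + (X\<^sup>2 - A * U\<^sup>2 - (B\<^sup>2 - 4 * A * C))"
    unfolding j_def u_def by algebra
  then have "p dvd 4 * A * (A * j\<^sup>2 + B * j + C - u\<^sup>2)"
    using z h XU by (simp add: dvd_diff dvd_add)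
  then have "p dvd A * j\<^sup>2 + B * j + C - u\<^sup>2" using A4 p prime_dvd_multD by blast
  ultimately show ?thesis by blast
qed

text \<open>Hensel lifting: one Newton step with \<open>z\<close> inverse to \<open>2 * t'\<close>
  gains a factor \<open>p\<close>.\<close>

lemma sqrt_lift:
  fixes p D t :: int
  assumes p: "prime p" "\<not> p dvd 2" and t: "\<not> p dvd t" "p dvd D - t\<^sup>2"
  shows "\<exists>t'. \<not> p dvd t' \<and> p ^ Suc k dvd D - t'\<^sup>2"
proof (induction k)
  case 0
  with t show ?case by auto
next
  case (Suc k)
  then obtain t' e where t': "\<not> p dvd t'" and e: "D - t'\<^sup>2 = p ^ Suc k * e" by (metis dvdE)
  have "\<not> p dvd 2 * t'" using t' p by (simp add: prime_dvd_mult_iff)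
  then obtain z where z: "p dvd 2 * t' * z - 1" using prime_inverse_mod[OF p(1)] by blast
  define s where "s = t' + p ^ Suc k * (e * z)"
  have "p dvd p ^ Suc k * (e * z)" by simp
  then have "\<not> p dvd s" using t' unfolding s_def by (simp add: dvd_add_left_iff)
  moreover have "D - (t' + P * (e * z))\<^sup>2 = - (P * ((2 * t' * z - 1) * e)) - P * (P * (e * z)\<^sup>2)"
    if "D - t'\<^sup>2 = P * e" for P
    using that by algebra
  from this[OF e]
  have "D - s\<^sup>2 = - (p ^ Suc k * ((2 * t' * z - 1) * e)) - p ^ Suc k * (p ^ Suc k * (e * z)\<^sup>2)"
    unfolding s_def .
  moreover have "p ^ Suc (Suc k) dvd p ^ Suc k * ((2 * t' * z - 1) * e)"
    unfolding power_Suc2[of p "Suc k"] by (intro mult_dvd_mono dvd_refl dvd_mult2 z)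
  moreover have "p ^ Suc (Suc k) dvd p ^ Suc k * (p ^ Suc k * (e * z)\<^sup>2)"
    unfolding power_Suc2[of p "Suc k"] by (intro mult_dvd_mono dvd_refl) simp
  ultimately show ?case by (metis dvd_diff dvd_minus_iff)
qed

text \<open>The root is \<open>- 2 C / (B + t)\<close> for a square root \<open>t\<close> of the discriminant; in this form it
  also makes sense for \<open>A = 0\<close>. As \<open>2 t\<close> is a unit, so is \<open>B + t\<close> or \<open>B - t\<close>.\<close>

lemma quadratic_root:
  fixes p A B C t :: int
  assumes p: "prime p" "\<not> p dvd 2" and t: "\<not> p dvd t" "p dvd B\<^sup>2 - 4 * A * C - t\<^sup>2"
  shows "\<exists>j. p ^ Suc k dvd A * j\<^sup>2 + B * j + C"
proof -
  obtain t' where t': "\<not> p dvd t'" "p ^ Suc k dvd B\<^sup>2 - 4 * A * C - t'\<^sup>2"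
    using sqrt_lift[OF p t] by blast
  have "\<not> (p dvd B + t' \<and> p dvd B + - t')"
  proof
    assume "p dvd B + t' \<and> p dvd B + - t'"
    then have "p dvd (B + t') - (B + - t')" using dvd_diff by blast
    then show False using p t' by (simp add: prime_dvd_mult_iff flip: mult_2)
  qed
  then obtain u where u: "\<not> p dvd B + u" and u2: "u\<^sup>2 = t'\<^sup>2" by (metis power2_minus)
  have cop: "coprime (B + u) (p ^ Suc k)"
    using u p prime_imp_coprime by (metis coprime_commute coprime_power_right_iff)
  then obtain z where "[(B + u) * z = 1] (mod p ^ Suc k)" using cong_solve_coprime_int by blast
  then have z: "p ^ Suc k dvd (B + u) * z - 1" by (simp add: cong_iff_dvd_diff)
  define j where "j = - 2 * C * z"
  have "(B + u)\<^sup>2 * (A * j\<^sup>2 + B * j + C) = ((B + u) * z - 1)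
      * (4 * A * C\<^sup>2 * ((B + u) * z + 1) - 2 * B * C * (B + u)) - C * (B\<^sup>2 - 4 * A * C - u\<^sup>2)"
    unfolding j_def by algebra
  then have "p ^ Suc k dvd (B + u)\<^sup>2 * (A * j\<^sup>2 + B * j + C)"
    using z t'(2) unfolding u2 by (metis dvd_diff dvd_mult dvd_mult2)
  moreover have "coprime (p ^ Suc k) ((B + u)\<^sup>2)"
    using cop by (metis coprime_commute coprime_power_right_iff)
  ultimately show ?thesis using coprime_dvd_mult_right_iff by blast
qed

section \<open>Orbits of integral Descartes quadruples\<close>

text \<open>The arithmetic of the curvatures without the circles. Adjacent swaps generate all
  permutations, so reflecting the first entry yields every \<open>S_i\<close>.\<close>

locale descartes_orbit =
  fixes Q :: "int \<Rightarrow> int \<Rightarrow> int \<Rightarrow> int \<Rightarrow> bool"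
  assumes swap12: "Q a b c d \<Longrightarrow> Q b a c d"
    and swap23: "Q a b c d \<Longrightarrow> Q a c b d"
    and swap34: "Q a b c d \<Longrightarrow> Q a b d c"
    and reflect: "Q a b c d \<Longrightarrow> Q (2 * (b + c + d) - a) b c d"
    and descartes: "Q a b c d \<Longrightarrow> 2 * (a\<^sup>2 + b\<^sup>2 + c\<^sup>2 + d\<^sup>2) = (a + b + c + d)\<^sup>2"
    and primitive: "\<lbrakk>Q a b c d; prime p\<rbrakk> \<Longrightarrow> \<not> (p dvd a \<and> p dvd b \<and> p dvd c \<and> p dvd d)"
begin

lemma swap13: "Q a b c d \<Longrightarrow> Q c b a d"
  by (blast intro: swap12 swap23)

lemma swap14: "Q a b c d \<Longrightarrow> Q d b c a"
  by (blast intro: swap13 swap34)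

text \<open>Reflecting the first two curvatures alternately runs through the chain of circles touching
  the circles of curvatures \<open>c\<close> and \<open>d\<close>; its \<open>j\<close>-th curvature is \<open>chain a b (c + d) j\<close>.\<close>

definition chain :: "int \<Rightarrow> int \<Rightarrow> int \<Rightarrow> int \<Rightarrow> int" where
  "chain a b s j = s * j\<^sup>2 + (b - a - s) * j + a"

text \<open>The chain has constant second difference \<open>2 * (c + d)\<close>, as reflection
  prescribes. Two reflections restore the order of the entries, so the first one sits at an even
  index.\<close>

lemma chain_reachable:
  assumes "Q a b c d"
  shows "Q (chain a b (c + d) (2 * int n)) (chain a b (c + d) (2 * int n + 1)) c d"
proof (induction n)
  case 0
  with assms show ?case by (simp add: chain_def)
next
  case (Suc n)
  have step: "2 * (chain a b (c + d) (j + 1) + c + d) - chain a b (c + d) j = chain a b (c + d) (j + 2)"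
    for j by (simp add: chain_def power2_eq_square algebra_simps)
  have "Q (chain a b (c + d) (2 * int n + 2)) (chain a b (c + d) (2 * int n + 1)) c d"
    using reflect[OF Suc] unfolding step .
  then have "Q (chain a b (c + d) (2 * int n + 1)) (chain a b (c + d) (2 * int n + 2)) c d"
    by (rule swap12)
  from reflect[OF this] step[of "2 * int n + 1"]
  have "Q (chain a b (c + d) (2 * int n + 3)) (chain a b (c + d) (2 * int n + 2)) c d"
    by (simp add: add.commute)
  from swap12[OF this] show ?case by (simp add: algebra_simps)
qed

lemma cong_chain: "[i = j] (mod m) \<Longrightarrow> [chain a b s i = chain a b s j] (mod m)"
  unfolding chain_def by (intro cong_add cong_mult cong_pow cong_refl)

text \<open>Since \<open>(q + 1) div 2\<close> inverts 2 modulo \<open>q\<close>, an even index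
  \<open>2 * n\<close> can be congruent to \<open>j\<close>; taking \<open>n\<close> divisible by
  \<open>M\<close> as well makes the chain look unmoved modulo \<open>M\<close>.\<close>

lemma chain_cong_reachable:
  assumes Q: "Q a b c d" and q: "odd q" "q > 0" and M: "M > 0" "coprime q M"
  shows "\<exists>a' b'. Q a' b' c d \<and> [a' = chain a b (c + d) j] (mod q) \<and> [a' = a] (mod M) \<and> [b' = b] (mod M)"
proof -
  from q have "2 * ((q + 1) div 2) = q + 1" by presburger
  then have "2 * (j * ((q + 1) div 2)) = j + q * j" by (metis mult.left_commute mult.commute distrib_left mult.right_neutral add.commute)
  then have h: "[2 * (j * ((q + 1) div 2)) = j] (mod q)" by (simp add: cong_iff_dvd_diff)
  obtain x where x: "[x = j * ((q + 1) div 2)] (mod q)" "[x = 0] (mod M)"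
    using binary_chinese_remainder_int[OF M(2)] by blast
  define n where "n = nat (x mod (q * M))"
  have n: "int n = x mod (q * M)" using q M by (simp add: n_def)
  then have nq: "[int n = x] (mod q)" and nM: "[int n = x] (mod M)"
    by (simp_all add: cong_def mod_mod_cancel)
  have "[2 * int n = j] (mod q)"
    using cong_trans[OF cong_mult[OF cong_refl cong_trans[OF nq x(1)]] h] .
  moreover have M0: "[2 * int n = 0] (mod M)"
    using cong_mult[OF cong_refl[of 2] cong_trans[OF nM x(2)]] by simp
  moreover have "[2 * int n + 1 = 1] (mod M)"
    using cong_add[OF M0 cong_refl[of 1]] by simp
  moreover have "chain a b s 0 = a" "chain a b s 1 = b" for s by (simp_all add: chain_def)
  ultimately show ?thesis using chain_reachable[OF Q, of n] cong_chain by metis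
qed

text \<open>The Descartes equation with the square completed in \<open>b\<close>. The left side is
  the squared linear coefficient of the chain, so this evaluates discriminants.\<close>

lemma chain_slope_square:
  assumes "Q a b c d"
  shows "(b - a - (c + d))\<^sup>2 = 4 * a * (c + d) + 4 * c * d"
  using descartes[OF assms] by algebra

text \<open>With both values excluded along \<open>0, \<dots>, 4\<close>, the fourth and second differences of the
  product show that the chain is constant modulo \<open>p\<close>, which forces \<open>c\<close> and \<open>d\<close> to vanish.\<close>

lemma chain_avoids:
  assumes Q: "Q a b c d" and p: "prime p" "p > 3" and cd: "\<not> (p dvd c \<and> p dvd d)"
  shows "\<exists>j. \<not> p dvd chain a b (c + d) j - e \<and> \<not> p dvd chain a b (c + d) j - f"
proof (rule ccontr)
  assume "\<not> ?thesis"
  define h where "h j = (chain a b (c + d) j - e) * (chain a b (c + d) j - f)" for j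
  from \<open>\<not> ?thesis\<close> have h: "p dvd h j" for j unfolding h_def by (metis dvd_mult dvd_mult2)
  define s where "s = c + d"
  define \<beta> where "\<beta> = b - a - s"
  have h_eq: "h j = (s * j\<^sup>2 + \<beta> * j + a - e) * (s * j\<^sup>2 + \<beta> * j + a - f)" for j
    by (simp add: h_def chain_def \<beta>_def s_def)
  have "h 0 - 4 * h 1 + 6 * h 2 - 4 * h 3 + h 4 = 24 * s\<^sup>2"
    unfolding h_eq by (simp add: power2_eq_square algebra_simps)
  moreover have "p dvd h 0 - 4 * h 1 + 6 * h 2 - 4 * h 3 + h 4"
    by (intro dvd_add dvd_diff dvd_mult h)
  ultimately have "p dvd 24 * s\<^sup>2" by simp
  then have s: "p dvd s"
    using prime_not_dvd_small[OF p] p by (simp add: prime_dvd_mult_iff prime_dvd_power_iff)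
  have "h 0 - 2 * h 1 + h 2 = 2 * \<beta>\<^sup>2 + s * (2 * (a - e) + 2 * (a - f) + 12 * \<beta> + 14 * s)"
    unfolding h_eq by (simp add: power2_eq_square algebra_simps)
  moreover have "p dvd h 0 - 2 * h 1 + h 2"
    by (intro dvd_add dvd_diff dvd_mult h)
  ultimately have "p dvd 2 * \<beta>\<^sup>2" using s by (metis dvd_add_left_iff dvd_mult2)
  then have "p dvd \<beta>\<^sup>2" using prime_not_dvd_small[OF p] p by (simp add: prime_dvd_mult_iff)
  moreover have "\<beta>\<^sup>2 = 4 * a * s + 4 * (c * d)"
    using chain_slope_square[OF Q] by (simp add: \<beta>_def s_def)
  ultimately have "p dvd 4 * (c * d)" using s by (metis dvd_add_right_iff dvd_mult)
  then have "p dvd c \<or> p dvd d"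
    using prime_not_dvd_small[OF p] p by (simp add: prime_dvd_mult_iff)
  with s cd show False unfolding s_def by (metis dvd_add_left_iff dvd_add_right_iff)
qed

lemma avoid_residues:
  assumes Q: "Q a b c d" and p: "prime p" "p > 3" and M: "M > 0" "coprime p M"
    and cd: "\<not> (p dvd c \<and> p dvd d)"
  shows "\<exists>a' b'. Q a' b' c d \<and> [a' = a] (mod M) \<and> [b' = b] (mod M) \<and>
    \<not> p dvd a' - e \<and> \<not> p dvd a' - f"
proof -
  obtain j where j: "\<not> p dvd chain a b (c + d) j - e" "\<not> p dvd chain a b (c + d) j - f"
    using chain_avoids[OF Q p cd] by blast
  have "odd p" "p > 0" using p prime_odd_int by fastforce+
  from chain_cong_reachable[OF Q this M] obtain a' b'
    where *: "Q a' b' c d" "[a' = a] (mod M)" "[b' = b] (mod M)" "[a' = chain a b (c + d) j] (mod p)"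
    by blast
  have "p dvd a' - g \<longleftrightarrow> p dvd chain a b (c + d) j - g" for g
    using cong_diff[OF *(4) cong_refl[of g]] by (rule cong_dvd_iff[OF _])
  with * j show ?thesis by blast
qed

text \<open>To move \<open>d\<close>, two curvatures not both divisible by \<open>p\<close> must
  stay fixed: \<open>a\<close> and \<open>b\<close>, or else \<open>a\<close> and \<open>c\<close>.
  If \<open>p\<close> divided all three, the Descartes equation would make it divide
  \<open>d\<close> too, against primitivity.\<close>

lemma reach_last_avoiding:
  assumes Q: "Q a b c d" and p: "prime p" "p > 3" and M: "M > 0" "coprime p M"
  shows "\<exists>a' b' c' d'. Q a' b' c' d' \<and> [a' = a] (mod M) \<and> [b' = b] (mod M) \<and> [c' = c] (mod M) \<and>
    [d' = d] (mod M) \<and> \<not> p dvd d' - e \<and> \<not> p dvd d' - f"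
proof (cases "p dvd a \<and> p dvd b")
  case False
  have "Q d c b a" using Q by (blast intro: swap14 swap23)
  from avoid_residues[OF this p M] False obtain d' c' where
    "Q d' c' b a" "[d' = d] (mod M)" "[c' = c] (mod M)" "\<not> p dvd d' - e" "\<not> p dvd d' - f" by blast
  moreover from this(1) have "Q a b c' d'" by (blast intro: swap14 swap23)
  ultimately show ?thesis using cong_refl by blast
next
  case True
  have "\<not> p dvd c"
  proof
    assume "p dvd c"
    with True have "p dvd a + b + c" by simp
    moreover have "d\<^sup>2 = 2 * d * (a + b + c) + (a + b + c)\<^sup>2 - 2 * (a\<^sup>2 + b\<^sup>2 + c\<^sup>2)"
      using descartes[OF Q] by algebra
    ultimately have "p dvd d\<^sup>2" using True \<open>p dvd c\<close> by (simp add: power2_eq_square dvd_add dvd_diff)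
    then have "p dvd d" using p by (simp add: prime_dvd_power_iff)
    with True \<open>p dvd c\<close> primitive[OF Q p(1)] show False by blast
  qed
  have "Q d b a c" using Q by (blast intro: swap14 swap34)
  with avoid_residues[OF this p M] \<open>\<not> p dvd c\<close> obtain d' b' where
    "Q d' b' a c" "[d' = d] (mod M)" "[b' = b] (mod M)" "\<not> p dvd d' - e" "\<not> p dvd d' - f" by blast
  moreover from this(1) have "Q a b' c d'" by (blast intro: swap14 swap34)
  ultimately show ?thesis using cong_refl by blast
qed

text \<open>Solving \<open>chain a b (c + d) j = r\<close> for \<open>j\<close> has discriminant \<open>4 (c (d + r) + d r)\<close>.\<close>

lemma reach_residue_prime_power:
  assumes Q: "Q a b c d" and p: "prime p" "p > 3" and M: "M > 0" "coprime p M"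
  shows "\<exists>a' b' c' d'. Q a' b' c' d' \<and> [a' = a] (mod M) \<and> [a' = r] (mod p ^ Suc k)"
proof -
  have odd: "odd p" "p > 0" using p prime_odd_int by fastforce+
  \<comment> \<open>The excluded values are those where a factor \<open>d1\<close>,
    \<open>d1 + r\<close>, \<open>a2 + d1\<close> or \<open>a2 - r\<close> of the leading
    coefficient or discriminant of the quadratic in \<open>j\<close> below would vanish modulo
    \<open>p\<close>.\<close>
  obtain a1 b1 c1 d1 where 1: "Q a1 b1 c1 d1" "[a1 = a] (mod M)"
    and d1: "\<not> p dvd d1 - 0" "\<not> p dvd d1 - (- r)"
    using reach_last_avoiding[OF Q p M] by blast
  obtain a2 b2 where 2: "Q a2 b2 c1 d1" "[a2 = a1] (mod M)"
    and a2: "\<not> p dvd a2 - (- d1)" "\<not> p dvd a2 - r"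
    using avoid_residues[OF 1(1) p M, of "- d1" r] d1 by auto
  have Q2: "Q c1 b2 a2 d1" using 2 by (blast intro: swap13)
  define S where "S = a2 + d1"
  define \<beta> where "\<beta> = b2 - c1 - S"
  have \<beta>: "\<beta>\<^sup>2 = 4 * c1 * S + 4 * a2 * d1"
    using chain_slope_square[OF Q2] by (simp add: \<beta>_def S_def)
  have "((d1 + r) * \<beta>)\<^sup>2 - 4 * ((d1 + r) * S) * ((d1 + r) * c1 + d1 * r) = 4 * (d1 + r) * d1 * d1 * (a2 - r)"
    using \<beta> S_def by algebra
  moreover have "\<not> p dvd 4 * (d1 + r) * d1 * d1 * (a2 - r)" "\<not> p dvd (d1 + r) * S"
    using d1 a2 prime_not_dvd_small[OF p] unfolding S_def prime_dvd_mult_iff[OF p(1)] by simp_all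
  ultimately obtain j u where u: "\<not> p dvd u"
    and j: "p dvd (d1 + r) * S * j\<^sup>2 + (d1 + r) * \<beta> * j + ((d1 + r) * c1 + d1 * r) - u\<^sup>2"
    using quadratic_takes_square[OF p, of "(d1 + r) * S" "(d1 + r) * \<beta>" "(d1 + r) * c1 + d1 * r"] by metis
  \<comment> \<open>Moving \<open>c1\<close> while \<open>a2\<close> and \<open>d1\<close> stay
    fixed makes \<open>c3 * (d1 + r) + d1 * r\<close> congruent to \<open>u\<^sup>2\<close>, so the
    final equation for \<open>i\<close> has discriminant \<open>(2 * u)\<^sup>2\<close> modulo
    \<open>p\<close>.\<close>
  obtain c3 b3 where 3: "Q c3 b3 a2 d1" "[c3 = chain c1 b2 S j] (mod p)"
    using chain_cong_reachable[OF Q2 odd M] unfolding S_def by blast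
  have Q3: "Q a2 b3 c3 d1" using 3 by (blast intro: swap13)
  have "(d1 + r) * chain c1 b2 S j + d1 * r - u\<^sup>2
      = (d1 + r) * S * j\<^sup>2 + (d1 + r) * \<beta> * j + ((d1 + r) * c1 + d1 * r) - u\<^sup>2"
    by (simp add: chain_def \<beta>_def algebra_simps)
  with j have dvd1: "p dvd (d1 + r) * chain c1 b2 S j + d1 * r - u\<^sup>2" by (simp only:)
  have dvd2: "p dvd c3 - chain c1 b2 S j" using 3(2) by (simp add: cong_iff_dvd_diff)
  define s where "s = c3 + d1"
  have "(b3 - a2 - s)\<^sup>2 - 4 * s * (a2 - r) - (2 * u)\<^sup>2
      = 4 * ((d1 + r) * (c3 - chain c1 b2 S j)) + 4 * ((d1 + r) * chain c1 b2 S j + d1 * r - u\<^sup>2)"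
    using chain_slope_square[OF Q3] unfolding s_def by algebra
  with dvd1 dvd2 have "p dvd (b3 - a2 - s)\<^sup>2 - 4 * s * (a2 - r) - (2 * u)\<^sup>2"
    by (metis dvd_add dvd_mult)
  moreover have "\<not> p dvd 2 * u" using u prime_not_dvd_small[OF p] p by (simp add: prime_dvd_mult_iff)
  ultimately obtain i where "p ^ Suc k dvd s * i\<^sup>2 + (b3 - a2 - s) * i + (a2 - r)"
    using quadratic_root[OF p(1) prime_not_dvd_small(1)[OF p]] by blast
  then have i: "[chain a2 b3 s i = r] (mod p ^ Suc k)"
    by (simp add: cong_iff_dvd_diff chain_def algebra_simps)
  have "odd (p ^ Suc k)" "p ^ Suc k > 0" "coprime (p ^ Suc k) M" using odd M by auto
  with chain_cong_reachable[OF Q3 _ _ M(1)] obtain a4 b4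
    where "Q a4 b4 c3 d1" "[a4 = a2] (mod M)" "[a4 = chain a2 b3 s i] (mod p ^ Suc k)"
    unfolding s_def by blast
  then show ?thesis using i 1(2) 2(2) by (meson cong_trans)
qed

text \<open>Induction splits off the full power of a prime divisor. The cofactor \<open>n'\<close>
  is treated first; the step for the prime power then preserves the first curvature modulo
  \<open>n'\<close>.\<close>

lemma reach_residue:
  assumes "Q a b c d" "coprime n 6"
  shows "\<exists>a' b' c' d'. Q a' b' c' d' \<and> [a' = r] (mod int n)"
  using assms
proof (induction n arbitrary: a b c d rule: less_induct)
  case (less n)
  show ?case
  proof (cases "n = 1")
    case True
    with less.prems show ?thesis by auto
  next
    case False
    have n0: "n \<noteq> 0"
    proof
      assume "n = 0"
      with less.prems(2) show False by simp
    qed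
    obtain p where p: "prime p" "p dvd n" using False prime_factor_nat by blast
    obtain n' where n': "n = p ^ multiplicity p n * n'" "\<not> p dvd n'"
      using multiplicity_decompose'[of n p] n0 p not_prime_unit by blast
    have "multiplicity p n > 0" using p n0 by (simp add: prime_multiplicity_gt_zero_iff)
    then obtain k where k: "multiplicity p n = Suc k" using gr0_implies_Suc by blast
    have "n' > 0" using n' n0 by (cases n') auto
    have "p \<le> p ^ Suc k" using p prime_ge_1_nat by (intro self_le_power) auto
    then have "p * n' \<le> n" using n'(1) k by (metis mult_le_mono1)
    moreover have "1 * n' < p * n'" using p \<open>n' > 0\<close> prime_gt_1_nat by (intro mult_strict_right_mono) auto
    ultimately have "n' < n" by linarith
    moreover have "coprime n' 6" using less.prems(2) n' by (metis coprime_mult_left_iff)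
    ultimately obtain a1 b1 c1 d1 where 1: "Q a1 b1 c1 d1" "[a1 = r] (mod int n')"
      using less.IH less.prems(1) by blast
    have "coprime p 6" using less.prems(2) p by (metis coprime_divisors dvd_refl)
    then have "\<not> p dvd 6" using p by (metis coprime_absorb_left not_prime_unit)
    moreover have "p \<noteq> 0" "p \<noteq> 1" using p by auto
    moreover have "p \<noteq> 2" "p \<noteq> 3" using \<open>\<not> p dvd 6\<close> by auto
    ultimately have "p > 3" by linarith
    have "coprime p n'" using p n' prime_imp_coprime by blast
    from reach_residue_prime_power[OF 1(1), of "int p" "int n'" r k]
    obtain a2 b2 c2 d2 where 2: "Q a2 b2 c2 d2" "[a2 = a1] (mod int n')" "[a2 = r] (mod int p ^ Suc k)"
      using p \<open>p > 3\<close> \<open>n' > 0\<close> \<open>coprime p n'\<close> by auto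
    have "[a2 = r] (mod int p ^ Suc k * int n')"
      using 2(3) cong_trans[OF 2(2) 1(2)] \<open>coprime p n'\<close>
      by (intro coprime_cong_mult) (auto simp: coprime_commute)
    with 2(1) n'(1) k show ?thesis by (metis of_nat_mult of_nat_power)
  qed
qed

end

section \<open>Curvatures of a packing\<close>

definition curvature_quadruple :: "gcircle set \<Rightarrow> int \<Rightarrow> int \<Rightarrow> int \<Rightarrow> int \<Rightarrow> bool" where
  "curvature_quadruple P a b c d \<longleftrightarrow> (\<exists>x y z w. {x, y, z, w} \<subseteq> P \<and> descartes_config {x, y, z, w} \<and>
     curvature x = a \<and> curvature y = b \<and> curvature z = c \<and> curvature w = d)"

lemma curvature_quadrupleI:
  assumes "{x, y, z, w} \<subseteq> P" "descartes_config {x, y, z, w}"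
    "curvature x = of_int a" "curvature y = of_int b" "curvature z = of_int c" "curvature w = of_int d"
  shows "curvature_quadruple P a b c d"
  using assms unfolding curvature_quadruple_def by blast

lemma curvature_quadrupleE:
  assumes "curvature_quadruple P a b c d"
  obtains x y z w where "{x, y, z, w} \<subseteq> P" "descartes_config {x, y, z, w}"
    "curvature x = of_int a" "curvature y = of_int b" "curvature z = of_int c" "curvature w = of_int d"
  using assms unfolding curvature_quadruple_def by blast

text \<open>The reflected circle completes \<open>y\<close>, \<open>z\<close>, \<open>w\<close> to a
  Descartes configuration, so it lies in \<open>P\<close> by \<open>fill\<close>. A prime dividing
  all four curvatures would divide their \<open>Gcd\<close>.\<close>

lemma packing_descartes_orbit:
  assumes "primitive_integral_packing P"
  shows "descartes_orbit (curvature_quadruple P)"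
proof
  fix a b c d :: int
  assume "curvature_quadruple P a b c d"
  then obtain x y z w where P: "{x, y, z, w} \<subseteq> P" and D: "descartes_config {x, y, z, w}"
    and curv: "curvature x = of_int a" "curvature y = of_int b"
      "curvature z = of_int c" "curvature w = of_int d"
    by (rule curvature_quadrupleE)
  show "curvature_quadruple P b a c d"
    using P D curv by (intro curvature_quadrupleI[of y x z w]) (simp_all add: insert_commute)
  show "curvature_quadruple P a c b d"
    using P D curv by (intro curvature_quadrupleI[of x z y w]) (simp_all add: insert_commute)
  show "curvature_quadruple P a b d c"
    using P D curv by (intro curvature_quadrupleI[of x y w z]) (simp_all add: insert_commute)
  obtain x' where x': "descartes_config {y, z, w, x'}"
    "curvature x' = 2 * (curvature y + curvature z + curvature w) - curvature x"
    using reflected_circle[OF D] .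
  have "x' \<in> P"
    using assms P packing_from.fill[OF _ _ _ x'(1)]
    unfolding primitive_integral_packing_def integral_packing_def apollonian_packing_def by auto
  moreover have "{x', y, z, w} = {y, z, w, x'}" by auto
  ultimately show "curvature_quadruple P (2 * (b + c + d) - a) b c d"
    using P x' curv by (intro curvature_quadrupleI[of x' y z w]) simp_all
  have "real_of_int (2 * (a\<^sup>2 + b\<^sup>2 + c\<^sup>2 + d\<^sup>2)) = real_of_int ((a + b + c + d)\<^sup>2)"
    using descartes_equation[OF D] curv by simp
  then show "2 * (a\<^sup>2 + b\<^sup>2 + c\<^sup>2 + d\<^sup>2) = (a + b + c + d)\<^sup>2"
    by (simp only: of_int_eq_iff)
  have "{k::int. real_of_int k \<in> curvature ` {x, y, z, w}} = {a, b, c, d}"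
    using curv by auto
  then have "Gcd {a, b, c, d} = 1"
    using assms P D unfolding primitive_integral_packing_def by metis
  then have dvd: "q dvd 1" if "q dvd a" "q dvd b" "q dvd c" "q dvd d" for q
    using that Gcd_greatest[of "{a, b, c, d}" q] by auto
  show "\<not> (p dvd a \<and> p dvd b \<and> p dvd c \<and> p dvd d)" if "prime p" for p
    using dvd[of p] not_prime_unit that by blast
qed

lemma exists_curvature_quadruple:
  assumes "integral_packing P"
  shows "\<exists>a b c d. curvature_quadruple P a b c d"
proof -
  obtain D where D: "descartes_config D" and P: "P = packing_from D"
    using assms by (auto simp: integral_packing_def apollonian_packing_def)
  from D have "card D = 4" by (simp add: descartes_config_def)
  then obtain x y z w where D_eq: "D = {x, y, z, w}"
    by (auto simp: card_Suc_eq numeral_eq_Suc)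
  then have sub: "{x, y, z, w} \<subseteq> P" using P by (auto intro: packing_from.initial)
  moreover have "\<forall>u\<in>P. \<exists>k::int. curvature u = of_int k"
    using assms by (auto simp: integral_packing_def elim!: Ints_cases)
  ultimately obtain a b c d :: int where "curvature x = of_int a" "curvature y = of_int b"
    "curvature z = of_int c" "curvature w = of_int d"
    by (meson insert_subset)
  with sub D D_eq show ?thesis using curvature_quadrupleI by metis
qed

theorem theorem6p2:
  fixes P :: "gcircle set" and m :: int
  assumes "primitive_integral_packing P"
    and "gcd m 30 = 1"
  shows "\<forall>r::int. \<exists>x\<in>P. \<exists>k::int. curvature x = real_of_int k \<and> [k = r] (mod m)"
proof
  fix r :: int
  have "integral_packing P" using assms(1) by (simp add: primitive_integral_packing_def)
  from exists_curvature_quadruple[OF this] obtain a b c d where quad: "curvature_quadruple P a b c d"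
    by (elim exE)
  have "coprime m 30" using assms(2) by (simp add: coprime_iff_gcd_eq_1)
  then have "coprime m 6" by (rule coprime_divisors[of m m 6 30, rotated 2]) simp_all
  \<comment> \<open>\<open>reach_residue\<close> takes a natural modulus, while \<open>m\<close> may
    be negative.\<close>
  then have "coprime (int (nat \<bar>m\<bar>)) (int 6)" by simp
  then have "coprime (nat \<bar>m\<bar>) 6" by (simp only: coprime_int_iff)
  from descartes_orbit.reach_residue[OF packing_descartes_orbit[OF assms(1)] quad this, of r] obtain a' b' c' d'
    where quad': "curvature_quadruple P a' b' c' d'" and "[a' = r] (mod \<bar>m\<bar>)" by auto
  then have "[a' = r] (mod m)" by (simp add: cong_iff_dvd_diff)
  with quad' show "\<exists>x\<in>P. \<exists>k::int. curvature x = real_of_int k \<and> [k = r] (mod m)"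
    by (auto elim!: curvature_quadrupleE)
qed

end
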